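(* Let $p\ge 1$, let $(X,\mathfrak{F},\mu)$ be a non-atomic measure space, and let $\Phi: L^{p}(\mathbb{C},\mu)\to\mathbb{C}$ be a continuous valuation. If there exist continuous functions $h_k:\mathbb{R}\to\mathbb{R}$ with $h_k(0)=0$ ($k=1,2,3,4$) such that $$\Phi(c\chi_E)=\big(h_1(\Re c)+h_3(\Im c)\big)\mu(E)+i\big(h_2(\Re c)+h_4(\Im c)\big)\mu(E)$$ for all $c\in\mathbb{C}$ and all $E\in\mathfrak{F}$ with $\mu(E)<\infty$, then there exist constants $\gamma_k,\delta_k\ge 0$ ($k=1,2,3,4$) such that $|h_k(a)|\le\gamma_k|a|^p+\delta_k$ for all $a\in\mathbb{R}$, and $$\Phi(f)=\int_X (h_1\circ\Re f+h_3\circ\Im f)\,d\mu+i\int_X (h_2\circ\Re f+h_4\circ\Im f)\,d\mu$$ for all $f\in L^p(\mathbb{C},\mu)$. In addition, $\delta_k=0$ ($k=1,2,3,4$) if $\mu(X)=\infty$.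
   Context: $L^p(\mathbb{C},\mu)$ is the space of $\mu$-measurable functions $f:X\to\mathbb{C}$ with $\|f\|_p=(\int_X|f|^p\,d\mu)^{1/p}<\infty$, where functions equal $\mu$-almost everywhere are identified. $\Re f$ and $\Im f$ are the real and imaginary parts of $f$, and $\chi_E$ is the characteristic function of $E$. A measure space $(X,\mathfrak{F},\mu)$ is non-atomic if for every $E\in\mathfrak{F}$ with $\mu(E)>0$ there exists $F\in\mathfrak{F}$ with $F\subseteq E$ and $0<\mu(F)<\mu(E)$. For complex-valued functions $f,g$, define $f\vee g=\max(\Re f,\Re g)+i\max(\Im f,\Im g)$ and $f\wedge g=\min(\Re f,\Re g)+i\min(\Im f,\Im g)$ (pointwise). A function $\Phi:L^p(\mathbb{C},\mu)\to\mathbb{C}$ is a valuation if $\Phi(f\vee g)+\Phi(f\wedge g)=\Phi(f)+\Phi(g)$ for all $f,g\in L^p(\mathbb{C},\mu)$ and $\Phi(0)=0$. It is continuous if $\Phi(f_i)\to\Phi(f)$ whenever $\|f_i-f\|_p\to 0$.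
   Formalization: The measure space is assumed to have μ(X) > 0; if μ(X) = 0 then L^p = {0}, Φ = 0 and the h_k are unconstrained (e.g. h_k(a) = exp(|a|^{p+1}) − 1), so the growth bound fails. *)

theory Defs
  imports "HOL-Analysis.Analysis"
begin

definition non_atomic :: "'a measure \<Rightarrow> bool" where
  "non_atomic M \<longleftrightarrow> (\<forall>E\<in>sets M. emeasure M E > 0 \<longrightarrow>
     (\<exists>F\<in>sets M. F \<subseteq> E \<and> 0 < emeasure M F \<and> emeasure M F < emeasure M E))"

text \<open>The elements of the complex space $L^p$ are handled through their representatives, the
  measurable functions with integrable $p$-th power. The identification of functions that agree
  almost everywhere is made by \<open>Lp_functional\<close> below.\<close>

definition Lp_space :: "'a measure \<Rightarrow> real \<Rightarrow> ('a \<Rightarrow> complex) set" where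
  "Lp_space M p = {f \<in> borel_measurable M. integrable M (\<lambda>x. norm (f x) powr p)}"

definition Lp_norm :: "'a measure \<Rightarrow> real \<Rightarrow> ('a \<Rightarrow> complex) \<Rightarrow> real" where
  "Lp_norm M p f = (\<integral>x. norm (f x) powr p \<partial>M) powr (1 / p)"

definition complex_max :: "('a \<Rightarrow> complex) \<Rightarrow> ('a \<Rightarrow> complex) \<Rightarrow> 'a \<Rightarrow> complex" where
  "complex_max f g = (\<lambda>x. Complex (max (Re (f x)) (Re (g x))) (max (Im (f x)) (Im (g x))))"

definition complex_min :: "('a \<Rightarrow> complex) \<Rightarrow> ('a \<Rightarrow> complex) \<Rightarrow> 'a \<Rightarrow> complex" where
  "complex_min f g = (\<lambda>x. Complex (min (Re (f x)) (Re (g x))) (min (Im (f x)) (Im (g x))))"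

text \<open>A function on the quotient space $L^p$ is a function of the representatives that respects
  equality almost everywhere. Its values outside \<open>Lp_space M p\<close> are irrelevant.\<close>

definition Lp_functional :: "'a measure \<Rightarrow> real \<Rightarrow> (('a \<Rightarrow> complex) \<Rightarrow> complex) \<Rightarrow> bool" where
  "Lp_functional M p \<Phi> \<longleftrightarrow>
     (\<forall>f\<in>Lp_space M p. \<forall>g\<in>Lp_space M p. (AE x in M. f x = g x) \<longrightarrow> \<Phi> f = \<Phi> g)"

definition Lp_valuation :: "'a measure \<Rightarrow> real \<Rightarrow> (('a \<Rightarrow> complex) \<Rightarrow> complex) \<Rightarrow> bool" where
  "Lp_valuation M p \<Phi> \<longleftrightarrow> Lp_functional M p \<Phi> \<and>
     (\<forall>f\<in>Lp_space M p. \<forall>g\<in>Lp_space M p.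
        \<Phi> (complex_max f g) + \<Phi> (complex_min f g) = \<Phi> f + \<Phi> g) \<and>
     \<Phi> (\<lambda>x. 0) = 0"

definition Lp_continuous :: "'a measure \<Rightarrow> real \<Rightarrow> (('a \<Rightarrow> complex) \<Rightarrow> complex) \<Rightarrow> bool" where
  "Lp_continuous M p \<Phi> \<longleftrightarrow>
     (\<forall>F f. (\<forall>i::nat. F i \<in> Lp_space M p) \<longrightarrow> f \<in> Lp_space M p \<longrightarrow>
        (\<lambda>i. Lp_norm M p (\<lambda>x. F i x - f x)) \<longlonglongrightarrow> 0 \<longrightarrow> (\<lambda>i. \<Phi> (F i)) \<longlonglongrightarrow> \<Phi> f)"

end

theory Submission
  imports Defs
begin

text \<open>Everything takes place with one complex function \<open>W\<close>, where
  \<open>\<Phi> (c \<chi>\<^sub>E) = W c * \<mu> E\<close>. A valuation is additive on functions with disjoint supports, since both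
  pairs \<open>f, g\<close> and \<open>f + g, 0\<close> have the same maximum and minimum; this gives the integral formula for
  simple functions. By continuity at 0 there is \<open>e > 0\<close> such that \<open>\<bar>\<Phi> f\<bar> \<le> 1\<close> whenever
  \<open>\<integral> \<bar>f\<bar>\<^sup>p \<le> e\<close>. Testing this on \<open>c \<chi>\<^sub>E\<close> with \<open>\<mu> E\<close> comparable to \<open>e / \<bar>c\<bar>\<^sup>p\<close>, which is possible as the
  measure is non-atomic, bounds \<open>W c\<close> by a multiple of \<open>\<bar>c\<bar>\<^sup>p\<close>. With this bound, dominated
  convergence extends the integral formula to \<open>L\<^sup>p\<close>.\<close>

section \<open>Small sets in non-atomic measure spaces\<close>

text \<open>Splitting a set of finite measure into two pieces of positive measure leaves a piece
  with at most half of the measure; iterating this makes the measure arbitrarily small while it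
  stays positive.\<close>

lemma non_atomic_small_subset:
  assumes "non_atomic M" "E \<in> sets M" "emeasure M E > 0" "e > 0"
  obtains G where "G \<in> sets M" "G \<subseteq> E" "0 < emeasure M G" "emeasure M G \<le> ennreal e"
proof -
  \<comment> \<open>\<open>E\<close> may have infinite measure. A strictly smaller measure is
    finite, so from \<open>F\<close> on measures can be subtracted.\<close>
  obtain F where F: "F \<in> sets M" "F \<subseteq> E" "0 < emeasure M F" "emeasure M F < emeasure M E"
    using assms unfolding non_atomic_def by blast
  have fin: "emeasure M F < \<infinity>"
    using order_less_le_trans[OF F(4) top_greatest] by simp
  have halving: "\<exists>G\<in>sets M. G \<subseteq> F \<and> 0 < measure M G \<and> measure M G \<le> measure M F / 2 ^ n" for n
  proof (induction n)
    case 0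
    show ?case
      using F fin by (intro bexI[of _ F]) (auto simp: measure_def enn2real_positive_iff)
  next
    case (Suc n)
    then obtain G where G: "G \<in> sets M" "G \<subseteq> F" "0 < measure M G" "measure M G \<le> measure M F / 2 ^ n"
      by blast
    have finG: "emeasure M G < \<infinity>"
      using fin G(2) F(1) by (meson emeasure_mono le_less_trans)
    have "emeasure M G > 0"
      using G(3) by (metis measure_def enn2real_0 not_gr_zero less_irrefl)
    then obtain H where H: "H \<in> sets M" "H \<subseteq> G" "0 < emeasure M H" "emeasure M H < emeasure M G"
      using assms(1) G(1) unfolding non_atomic_def by blast
    have finH: "emeasure M H < \<infinity>" using H(4) finG by order
    have eqs: "emeasure M G = ennreal (measure M G)" "emeasure M H = ennreal (measure M H)"
      using finG finH by (simp_all add: emeasure_eq_ennreal_measure)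
    have mH: "0 < measure M H" "measure M H < measure M G"
      using H(3,4) by (simp_all add: eqs ennreal_less_iff)
    have diff: "measure M (G - H) = measure M G - measure M H"
      using finG G(1) H(1,2) by (intro measure_Diff) auto
    show ?case
    proof (cases "measure M H \<le> measure M G / 2")
      case True
      then show ?thesis
        using H mH G by (intro bexI[of _ H]) auto
    next
      case False
      then show ?thesis
        using H mH G diff by (intro bexI[of _ "G - H"]) auto
    qed
  qed
  have "(\<lambda>n. measure M F / 2 ^ n) \<longlonglongrightarrow> 0"
    by (rule LIMSEQ_divide_realpow_zero) simp
  then have "\<forall>\<^sub>F n in sequentially. measure M F / 2 ^ n < e"
    using \<open>e > 0\<close> by (rule order_tendstoD)
  then obtain n where n: "measure M F / 2 ^ n < e"
    using eventually_happens by fastforce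
  obtain G where G: "G \<in> sets M" "G \<subseteq> F" "0 < measure M G" "measure M G \<le> measure M F / 2 ^ n"
    using halving by blast
  have "emeasure M G < \<infinity>"
    using fin G(2) F(1) by (meson emeasure_mono le_less_trans)
  then have "emeasure M G = ennreal (measure M G)"
    by (simp add: emeasure_eq_ennreal_measure)
  then show ?thesis
    using G n F(2) by (intro that[of G]) (auto intro: ennreal_leI)
qed

text \<open>A weak form of Sierpinski's theorem: measures are prescribed up to a factor of 2 only. If
  there were no such set, then the sets of measure at most \<open>t\<close> would be closed under countable
  unions, and one of maximal measure could be enlarged.\<close>

lemma non_atomic_subset_between:
  assumes na: "non_atomic M" and E: "E \<in> sets M" and t: "t > 0" "ennreal t \<le> emeasure M E"
  obtains F where "F \<in> sets M" "F \<subseteq> E" "ennreal (t / 2) \<le> emeasure M F" "emeasure M F \<le> ennreal t"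
proof (rule ccontr)
  assume none: "\<not> thesis"
  note found = that
  \<comment> \<open>No subset has measure between \<open>t / 2\<close> and \<open>t\<close>, so
    measure at most \<open>t\<close> already means less than \<open>t / 2\<close>. Hence the union
    of two such sets again stays within \<open>t\<close>.\<close>
  have gap: "emeasure M F < ennreal (t / 2)"
    if F: "F \<in> sets M" "F \<subseteq> E" "emeasure M F \<le> ennreal t" for F
    using found[of F] none F by (meson not_le)
  define A where "A = {F \<in> sets M. F \<subseteq> E \<and> emeasure M F \<le> ennreal t}"
  have t_half: "ennreal t = ennreal (t / 2) + ennreal (t / 2)"
    using t(1) by (simp flip: ennreal_plus)
  have union: "F \<union> G \<in> A" if "F \<in> A" "G \<in> sets M" "G \<subseteq> E" "emeasure M G \<le> ennreal (t / 2)" for F G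
  proof -
    have "emeasure M (F \<union> G) \<le> emeasure M F + emeasure M G"
      using that by (intro emeasure_subadditive) (auto simp: A_def)
    also have "\<dots> \<le> ennreal t"
      unfolding t_half using that gap[of F] by (intro add_mono) (auto simp: A_def)
    finally show ?thesis
      using that by (auto simp: A_def)
  qed
  have "{} \<in> A" by (simp add: A_def)
  then have "emeasure M ` A \<noteq> {}" by auto
  from ennreal_Sup_countable_SUP[OF this]
  obtain f :: "nat \<Rightarrow> ennreal" where f: "range f \<subseteq> emeasure M ` A"
    "(SUP F\<in>A. emeasure M F) = (SUP i. f i)"
    by (elim exE conjE)
  have "\<forall>i. \<exists>F\<in>A. f i = emeasure M F" using f(1) by auto
  then obtain F where F: "\<And>i. F i \<in> A" "\<And>i. f i = emeasure M (F i)" by metis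
  define U where "U n = (\<Union>i\<le>n. F i)" for n :: nat
  have U: "U n \<in> A" for n
  proof (induction n)
    case 0
    then show ?case using F by (simp add: U_def)
  next
    case (Suc n)
    have "U (Suc n) = U n \<union> F (Suc n)" by (auto simp: U_def atMost_Suc)
    moreover have "emeasure M (F (Suc n)) \<le> ennreal (t / 2)"
      using F(1)[of "Suc n"] gap[of "F (Suc n)"] by (auto simp: A_def)
    ultimately show ?case using Suc union F(1)[of "Suc n"] by (auto simp: A_def)
  qed
  \<comment> \<open>The sets \<open>F i\<close> approach the supremum of the measures on
    \<open>A\<close>. Their union stays in \<open>A\<close> by continuity from below, so it attains
    this supremum.\<close>
  define V where "V = (\<Union>n. U n)"
  have "emeasure M V = (SUP n. emeasure M (U n))"
    unfolding V_def using U
    by (intro SUP_emeasure_incseq[symmetric])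
      (auto simp: A_def incseq_def, auto simp: U_def intro: order_trans)
  also have "\<dots> \<le> ennreal t"
    using U by (intro SUP_least) (auto simp: A_def)
  finally have V: "V \<in> A" using U by (auto simp: A_def V_def)
  have max: "emeasure M F' \<le> emeasure M V" if "F' \<in> A" for F'
  proof -
    have "emeasure M F' \<le> (SUP F\<in>A. emeasure M F)" using that by (rule SUP_upper)
    also have "\<dots> \<le> emeasure M V"
      unfolding f F using V by (intro SUP_least emeasure_mono) (auto simp: V_def U_def A_def)
    finally show ?thesis .
  qed
  have V_less: "emeasure M V < ennreal (t / 2)" using V gap by (auto simp: A_def)
  have "emeasure M (E - V) > 0"
  proof (rule ccontr)
    assume "\<not> emeasure M (E - V) > 0"
    then have "emeasure M E \<le> emeasure M V"
      using V E emeasure_subadditive[of V M "E - V"]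
      by (auto simp: A_def Un_absorb1 Un_Diff_cancel)
    moreover have "ennreal (t / 2) \<le> ennreal t" using t(1) by (intro ennreal_leI) auto
    ultimately show False using V_less t(2) by order
  qed
  then obtain G where G: "G \<in> sets M" "G \<subseteq> E - V" "0 < emeasure M G" "emeasure M G \<le> ennreal (t / 2)"
    using non_atomic_small_subset[OF na, of "E - V" "t / 2"] E V t(1) by (auto simp: A_def)
  have "V \<union> G \<in> A" using union[OF V G(1)] G by auto
  then have "emeasure M (V \<union> G) \<le> emeasure M V" by (rule max)
  moreover have "emeasure M (V \<union> G) = emeasure M V + emeasure M G"
    using V G by (intro plus_emeasure[symmetric]) (auto simp: A_def)
  \<comment> \<open>Strict because \<open>V\<close> has finite measure; in \<open>ennreal\<close>,
    adding to infinity changes nothing.\<close>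
  moreover have "emeasure M V < emeasure M V + emeasure M G"
    using ennreal_add_left_cancel_less[of "emeasure M V" 0 "emeasure M G"] G(3)
      order.strict_trans[OF V_less ennreal_less_top] by auto
  ultimately show False by order
qed

section \<open>Membership in L^p\<close>

text \<open>The sum of the two p-th powers is an integrable majorant. The dominating function may
  change from point to point, as happens for a sum of functions with disjoint supports.\<close>

lemma Lp_space_dominated:
  assumes "f \<in> Lp_space M p" "g \<in> Lp_space M p" "h \<in> borel_measurable M" "p \<ge> 1"
    and "\<And>x. x \<in> space M \<Longrightarrow> norm (h x) \<le> norm (f x) \<or> norm (h x) \<le> norm (g x)"
  shows "h \<in> Lp_space M p"
proof -
  have "integrable M (\<lambda>x. norm (f x) powr p + norm (g x) powr p)"
    using assms by (intro Bochner_Integration.integrable_add) (auto simp: Lp_space_def)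
  then have "integrable M (\<lambda>x. norm (h x) powr p)"
  proof (rule Bochner_Integration.integrable_bound)
    show "(\<lambda>x. norm (h x) powr p) \<in> borel_measurable M" using assms(3) by measurable
    have "norm (h x) powr p \<le> norm (f x) powr p + norm (g x) powr p" if "x \<in> space M" for x
      using assms(4) assms(5)[OF that]
      by (smt (verit) powr_mono2 norm_ge_zero powr_ge_zero)
    then show "AE x in M. norm (norm (h x) powr p) \<le> norm (norm (f x) powr p + norm (g x) powr p)"
      by (intro AE_I2) auto
  qed
  with assms(3) show ?thesis by (simp add: Lp_space_def)
qed

lemma Lp_space_scale:
  assumes "f \<in> Lp_space M p" "h \<in> borel_measurable M" "p \<ge> 1"
    and "\<And>x. x \<in> space M \<Longrightarrow> norm (h x) \<le> r * norm (f x)" "r \<ge> 0"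
  shows "h \<in> Lp_space M p"
proof -
  have "(\<lambda>x. of_real r * f x) \<in> Lp_space M p"
    using assms(1,5) by (auto simp: Lp_space_def norm_mult powr_mult)
  from Lp_space_dominated[OF this this assms(2,3)] show ?thesis
    using assms(4,5) by (simp add: norm_mult)
qed

lemma zero_in_Lp_space: "p \<ge> 1 \<Longrightarrow> (\<lambda>x. 0) \<in> Lp_space M p"
  by (simp add: Lp_space_def)

lemma indicator_in_Lp_space:
  assumes "E \<in> sets M" "emeasure M E < \<infinity>" "p \<ge> 1"
  shows "(\<lambda>x. c * indicator E x :: complex) \<in> Lp_space M p"
    and "(\<integral>x. norm (c * indicator E x :: complex) powr p \<partial>M) = norm c powr p * measure M E"
proof -
  have eq: "(\<lambda>x. norm (c * indicator E x :: complex) powr p) = (\<lambda>x. norm c powr p * indicator E x)"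
    using assms(3) by (auto simp: fun_eq_iff indicator_def)
  show "(\<lambda>x. c * indicator E x :: complex) \<in> Lp_space M p"
    unfolding Lp_space_def using assms by (simp add: eq)
  show "(\<integral>x. norm (c * indicator E x :: complex) powr p \<partial>M) = norm c powr p * measure M E"
    unfolding eq using assms by (simp add: Int_absorb2 sets.sets_into_space)
qed

section \<open>Additivity and boundedness of continuous valuations\<close>

lemma Lp_valuation_add_disjoint:
  assumes "Lp_valuation M p \<Phi>" "p \<ge> 1" "f \<in> Lp_space M p" "g \<in> Lp_space M p"
    and disj: "\<And>x. f x = 0 \<or> g x = 0"
  shows "(\<lambda>x. f x + g x) \<in> Lp_space M p" "\<Phi> (\<lambda>x. f x + g x) = \<Phi> f + \<Phi> g"
proof -
  have "(\<lambda>x. f x + g x) \<in> borel_measurable M"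
    using assms(3,4) by (auto simp: Lp_space_def)
  moreover have "norm (f x + g x) \<le> norm (f x) \<or> norm (f x + g x) \<le> norm (g x)" for x
    using disj[of x] by auto
  ultimately show fg: "(\<lambda>x. f x + g x) \<in> Lp_space M p"
    by (intro Lp_space_dominated[OF assms(3,4) _ assms(2)])
  have "complex_max f g = complex_max (\<lambda>x. f x + g x) (\<lambda>x. 0)"
    unfolding complex_max_def
  proof (rule ext)
    show "Complex (max (Re (f x)) (Re (g x))) (max (Im (f x)) (Im (g x))) =
      Complex (max (Re (f x + g x)) (Re 0)) (max (Im (f x + g x)) (Im 0))" for x
      using disj[of x] by (elim disjE) (simp_all add: max.commute)
  qed
  moreover have "complex_min f g = complex_min (\<lambda>x. f x + g x) (\<lambda>x. 0)"
    unfolding complex_min_def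
  proof (rule ext)
    show "Complex (min (Re (f x)) (Re (g x))) (min (Im (f x)) (Im (g x))) =
      Complex (min (Re (f x + g x)) (Re 0)) (min (Im (f x + g x)) (Im 0))" for x
      using disj[of x] by (elim disjE) (simp_all add: min.commute)
  qed
  moreover have "\<Phi> (complex_max f g) + \<Phi> (complex_min f g) = \<Phi> f + \<Phi> g"
    using assms(1,3,4) by (simp add: Lp_valuation_def)
  moreover have "\<Phi> (complex_max (\<lambda>x. f x + g x) (\<lambda>x. 0)) + \<Phi> (complex_min (\<lambda>x. f x + g x) (\<lambda>x. 0))
      = \<Phi> (\<lambda>x. f x + g x) + \<Phi> (\<lambda>x. 0)"
    using assms(1) fg zero_in_Lp_space[OF assms(2), of M] unfolding Lp_valuation_def by blast
  moreover have "\<Phi> (\<lambda>x. 0) = 0"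
    using assms(1) by (simp add: Lp_valuation_def)
  ultimately show "\<Phi> (\<lambda>x. f x + g x) = \<Phi> f + \<Phi> g"
    by simp
qed

text \<open>Otherwise there are functions with p-th power integral at most
  \<open>1 / (n + 1)\<close> and values of \<open>\<Phi>\<close> above 1 in modulus, against
  sequential continuity at 0. The radius refers to the integral, not to the norm, because for
  \<open>c * indicator E x\<close> the integral is linear in the measure of
  \<open>E\<close>.\<close>

lemma Lp_continuous_bounded_near_zero:
  assumes "Lp_continuous M p \<Phi>" "\<Phi> (\<lambda>x. 0) = 0" "p \<ge> 1"
  obtains e where "e > 0"
    "\<And>f. f \<in> Lp_space M p \<Longrightarrow> (\<integral>x. norm (f x) powr p \<partial>M) \<le> e \<Longrightarrow> norm (\<Phi> f) \<le> 1"
proof (rule ccontr)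
  assume "\<not> thesis"
  then have "\<exists>f\<in>Lp_space M p. (\<integral>x. norm (f x) powr p \<partial>M) \<le> inverse (real (Suc n)) \<and> norm (\<Phi> f) > 1" for n
    using that[of "inverse (real (Suc n))"] by (force simp: not_le)
  then obtain F where F: "\<And>n. F n \<in> Lp_space M p"
    "\<And>n. (\<integral>x. norm (F n x) powr p \<partial>M) \<le> inverse (real (Suc n))" "\<And>n. norm (\<Phi> (F n)) > 1"
    by metis
  have "(\<lambda>n. (\<integral>x. norm (F n x) powr p \<partial>M)) \<longlonglongrightarrow> 0"
    by (rule tendsto_sandwich[OF _ _ tendsto_const LIMSEQ_inverse_real_of_nat]) (use F(2) in auto)
  then have "(\<lambda>n. (\<integral>x. norm (F n x) powr p \<partial>M) powr (1 / p)) \<longlonglongrightarrow> 0 powr (1 / p)"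
    using assms(3) by (intro tendsto_powr2) auto
  then have "(\<lambda>n. Lp_norm M p (\<lambda>x. F n x - 0)) \<longlonglongrightarrow> 0"
    by (simp add: Lp_norm_def)
  then have "(\<lambda>n. \<Phi> (F n)) \<longlonglongrightarrow> \<Phi> (\<lambda>x. 0)"
    using assms(1) F(1) zero_in_Lp_space[OF assms(3), of M] unfolding Lp_continuous_def by blast
  then have "(\<lambda>n. norm (\<Phi> (F n))) \<longlonglongrightarrow> 0"
    using assms(2) by (simp add: tendsto_norm_zero)
  then have "\<forall>\<^sub>F n in sequentially. norm (\<Phi> (F n)) < 1"
    by (rule order_tendstoD) simp
  then obtain n where "norm (\<Phi> (F n)) < 1"
    using eventually_happens by fastforce
  with F(3)[of n] show False by simp
qed

section \<open>Growth bound and integral formula for one complex function\<close>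

locale indicator_valuation =
  fixes M :: "'a measure" and p :: real and \<Phi> :: "('a \<Rightarrow> complex) \<Rightarrow> complex" and W :: "complex \<Rightarrow> complex"
  assumes p: "p \<ge> 1"
    and val: "Lp_valuation M p \<Phi>"
    and cont: "Lp_continuous M p \<Phi>"
    and W_cont: "continuous_on UNIV W"
    and W_0: "W 0 = 0"
    and \<Phi>_indicator: "\<And>c E. E \<in> sets M \<Longrightarrow> emeasure M E < \<infinity> \<Longrightarrow>
      \<Phi> (\<lambda>x. c * indicator E x) = W c * of_real (measure M E)"
begin

text \<open>If \<open>\<mu> E\<close> is about \<open>e / norm c powr p\<close>, then
  \<open>c * indicator E x\<close> lies in the region where \<open>\<Phi>\<close> is bounded by 1,
  which bounds \<open>W c\<close>. A space of infinite measure has such sets for all nonzero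
  \<open>c\<close>, so \<open>\<delta> = 0\<close>; otherwise they may be missing for small
  \<open>c\<close>, where compactness bounds \<open>W\<close>. On a null space the values of
  \<open>\<Phi>\<close> on indicators would say nothing about \<open>W\<close>, hence
  \<open>pos\<close>.\<close>

lemma growth:
  assumes na: "non_atomic M" and pos: "emeasure M (space M) > 0"
  obtains \<gamma> \<delta> where "\<gamma> \<ge> 0" "\<delta> \<ge> 0" "\<And>c. norm (W c) \<le> \<gamma> * norm c powr p + \<delta>"
    "emeasure M (space M) = \<infinity> \<Longrightarrow> \<delta> = 0"
proof -
  obtain e where e: "e > 0"
    "\<And>f. f \<in> Lp_space M p \<Longrightarrow> (\<integral>x. norm (f x) powr p \<partial>M) \<le> e \<Longrightarrow> norm (\<Phi> f) \<le> 1"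
    using Lp_continuous_bounded_near_zero[OF cont _ p] val unfolding Lp_valuation_def by blast
  have large: "norm (W c) \<le> 2 / e * norm c powr p"
    if c: "c \<noteq> 0" "ennreal (e / norm c powr p) \<le> emeasure M (space M)" for c
  proof -
    \<comment> \<open>The largest measure for which the p-th power integral of
      \<open>c * indicator E x\<close> is at most \<open>e\<close>. The factor 2 in the bound is the
      price of knowing only \<open>t / 2 \<le> measure M E\<close>.\<close>
    define t where "t = e / norm c powr p"
    have "t > 0" using e(1) c(1) by (simp add: t_def)
    obtain E where E: "E \<in> sets M" "ennreal (t / 2) \<le> emeasure M E" "emeasure M E \<le> ennreal t"
      using non_atomic_subset_between[OF na sets.top \<open>t > 0\<close>] c(2) unfolding t_def by metis
    have fin: "emeasure M E < \<infinity>"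
      using E(3) by (simp add: le_less_trans)
    have "emeasure M E = ennreal (measure M E)"
      using fin by (simp add: emeasure_eq_ennreal_measure)
    then have mE: "t / 2 \<le> measure M E" "measure M E \<le> t"
      using E(2,3) \<open>t > 0\<close> by (simp_all add: ennreal_le_iff)
    have "norm c powr p * measure M E \<le> norm c powr p * t"
      using mE by (intro mult_left_mono) auto
    also have "\<dots> = e" using c(1) by (simp add: t_def)
    finally have "norm (\<Phi> (\<lambda>x. c * indicator E x)) \<le> 1"
      using indicator_in_Lp_space[OF E(1) fin p, of c] by (intro e(2)) auto
    then have "norm (W c) * measure M E \<le> 1"
      using \<Phi>_indicator[OF E(1) fin] by (simp add: norm_mult)
    moreover have "norm (W c) * (t / 2) \<le> norm (W c) * measure M E"
      using mE by (intro mult_left_mono) auto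
    ultimately have "norm (W c) \<le> 2 / t" using \<open>t > 0\<close> by (simp add: field_simps)
    then show ?thesis by (simp add: t_def)
  qed
  show ?thesis
  proof (cases "emeasure M (space M) = \<infinity>")
    case True
    have "norm (W c) \<le> 2 / e * norm c powr p + 0" for c
      using large[of c] W_0 True by (cases "c = 0") auto
    then show ?thesis using e(1) by (intro that[of "2 / e" 0]) auto
  next
    case False
    define m where "m = measure M (space M)"
    have m: "emeasure M (space M) = ennreal m"
      using False by (simp add: m_def emeasure_eq_ennreal_measure)
    then have "m > 0" using pos by simp
    \<comment> \<open>The threshold for \<open>large\<close>: for nonzero \<open>c\<close>, the
      whole space has measure at least \<open>e / norm c powr p\<close> exactly when
      \<open>norm c \<ge> R\<close>.\<close>
    define R where "R = (e / m) powr (1 / p)"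
    have "compact (W ` cball 0 R)"
      by (intro compact_continuous_image continuous_on_subset[OF W_cont]) auto
    then obtain B where B: "\<And>c. norm c \<le> R \<Longrightarrow> norm (W c) \<le> B"
      using compact_imp_bounded[of "W ` cball 0 R"] unfolding bounded_iff by (metis image_eqI mem_cball_0)
    have "B \<ge> 0" using B[of 0] by (simp add: W_0 R_def)
    have "norm (W c) \<le> 2 / e * norm c powr p + B" for c
    proof (cases "norm c \<le> R")
      case True
      then show ?thesis using B[of c] e(1) by (simp add: add.commute add_increasing2)
    next
      case False
      have "R \<ge> 0" by (simp add: R_def)
      then have "c \<noteq> 0" using False by auto
      have "e / m = R powr p"
        using e(1) \<open>m > 0\<close> p by (simp add: R_def powr_powr)
      also have "\<dots> \<le> norm c powr p"
        using False p \<open>R \<ge> 0\<close> by (intro powr_mono2) auto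
      finally have "e / norm c powr p \<le> m"
        using \<open>m > 0\<close> \<open>c \<noteq> 0\<close> by (simp add: field_simps)
      then show ?thesis
        using large[OF \<open>c \<noteq> 0\<close>] \<open>B \<ge> 0\<close> by (force simp: m intro: ennreal_leI)
    qed
    then show ?thesis using e(1) \<open>B \<ge> 0\<close> False by (intro that[of "2 / e" B]) auto
  qed
qed

text \<open>Induction over the finitely many nonzero values, splitting off one level set at a time
  by additivity on disjoint supports.\<close>

lemma simple_function_integral:
  assumes s: "simple_function M s" and Lp: "s \<in> Lp_space M p"
  shows "\<Phi> s = (\<integral>x. W (s x) \<partial>M)"
proof -
  \<comment> \<open>The part of \<open>s\<close> with values in \<open>A\<close>. The value 0 is
    kept out of \<open>A\<close> because its level set may have infinite measure.\<close>
  define g where "g A x = s x * indicator (s -` A \<inter> space M) x" for A x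
  have step: "g A \<in> Lp_space M p \<and> integrable M (\<lambda>x. W (g A x)) \<and> \<Phi> (g A) = (\<integral>x. W (g A x) \<partial>M)"
    if "finite A" "0 \<notin> A" for A
    using that
  proof (induction A rule: finite_induct)
    case empty
    have "g {} = (\<lambda>x. 0)" by (simp add: g_def fun_eq_iff)
    then show ?case
      using val p by (simp add: zero_in_Lp_space W_0 Lp_valuation_def)
  next
    case (insert y A)
    define E where "E = s -` {y} \<inter> space M"
    have E: "E \<in> sets M" using s by (auto simp: E_def simple_functionD)
    have int: "integrable M (\<lambda>x. norm (s x) powr p)" using Lp by (simp add: Lp_space_def)
    \<comment> \<open>Markov's inequality makes the level set of the nonzero value \<open>y\<close>
      finite in measure, so that \<open>\<Phi>_indicator\<close> applies.\<close>
    have "emeasure M E \<le> emeasure M {x \<in> space M. norm (s x) powr p \<ge> norm y powr p}"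
      using int by (intro emeasure_mono) (auto simp: E_def)
    also have "\<dots> \<le> ennreal (1 / norm y powr p * (\<integral>x. norm (s x) powr p \<partial>M))"
      using insert.prems by (intro integral_Markov_inequality int) auto
    finally have fin: "emeasure M E < \<infinity>"
      by (simp add: le_less_trans)
    let ?e = "\<lambda>x. y * indicator E x :: complex"
    have ge: "g (insert y A) = (\<lambda>x. ?e x + g A x)"
      using insert.hyps by (auto simp: g_def fun_eq_iff E_def indicator_def)
    have disj: "?e x = 0 \<or> g A x = 0" for x
      using insert.hyps by (auto simp: g_def E_def indicator_def)
    have We: "(\<lambda>x. W (?e x)) = (\<lambda>x. indicator E x *\<^sub>R W y)"
      by (auto simp: indicator_def W_0)
    note int_e = has_bochner_integral_indicator[OF E fin, of "W y"]
    have "integrable M (\<lambda>x. W (?e x))" "(\<integral>x. W (?e x) \<partial>M) = W y * of_real (measure M E)"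
      unfolding We
      using integrable.intros[OF int_e] has_bochner_integral_integral_eq[OF int_e]
      by (simp_all only: scaleR_conv_of_real mult.commute)
    \<comment> \<open>\<open>W\<close> need not be additive, but one of the summands is 0 and
      \<open>W 0 = 0\<close>.\<close>
    moreover have "W (?e x + g A x) = W (?e x) + W (g A x)" for x
      using disj[of x] by (auto simp: W_0)
    moreover note Lp_valuation_add_disjoint[OF val p indicator_in_Lp_space(1)[OF E fin p] _ disj]
    ultimately show ?case
      using insert \<Phi>_indicator[OF E fin, of y] unfolding ge by simp
  qed
  define A where "A = s ` space M - {0}"
  have g: "g A x = s x" if "x \<in> space M" for x
    using that by (auto simp: g_def A_def indicator_def)
  have A: "finite A" "0 \<notin> A" using simple_functionD(1)[OF s] by (auto simp: A_def)
  \<comment> \<open>The two functions agree on \<open>space M\<close> but possibly not outside it,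
    so the invariance of \<open>\<Phi>\<close> under equality almost everywhere is used.\<close>
  have "\<Phi> s = \<Phi> (g A)"
    using val Lp step[OF A] g unfolding Lp_valuation_def Lp_functional_def
    by (metis (mono_tags, lifting) AE_I2)
  also have "\<dots> = (\<integral>x. W (s x) \<partial>M)"
    using step[OF A] g by (auto intro!: Bochner_Integration.integral_cong)
  finally show ?thesis .
qed

text \<open>Simple functions \<open>F i\<close> with
  \<open>norm (F i x) \<le> 2 * norm (f x)\<close> converge to \<open>f\<close> pointwise. Dominated
  convergence is used twice: for convergence in L^p, which gives the limit of
  \<open>\<Phi> (F i)\<close>, and for the integrals of \<open>W (F i x)\<close>.\<close>

lemma integral_representation:
  assumes bound: "\<And>c. norm (W c) \<le> \<gamma> * norm c powr p + \<delta>" and "\<gamma> \<ge> 0" "\<delta> \<ge> 0"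
    and \<delta>: "emeasure M (space M) = \<infinity> \<Longrightarrow> \<delta> = 0"
    and f: "f \<in> Lp_space M p"
  shows "integrable M (\<lambda>x. W (f x))" "\<Phi> f = (\<integral>x. W (f x) \<partial>M)"
proof -
  have fm[measurable]: "f \<in> borel_measurable M" using f by (simp add: Lp_space_def)
  obtain F where F: "\<And>i. simple_function M (F i)"
    "\<And>x. x \<in> space M \<Longrightarrow> (\<lambda>i. F i x) \<longlonglongrightarrow> f x"
    "\<And>i x. x \<in> space M \<Longrightarrow> dist (F i x) 0 \<le> 2 * dist (f x) 0"
    using borel_measurable_implies_sequence_metric[OF fm, of 0] by blast
  have Fm[measurable]: "F i \<in> borel_measurable M" for i
    using F(1) by (rule borel_measurable_simple_function)
  have [measurable]: "W \<in> borel_measurable borel"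
    using W_cont by (rule borel_measurable_continuous_onI)
  have F_le: "norm (F i x) \<le> 2 * norm (f x)" if "x \<in> space M" for i x
    using F(3)[OF that, of i] by simp
  have F_Lp: "F i \<in> Lp_space M p" for i
    by (rule Lp_space_scale[OF f Fm p F_le]) auto
  have int_f: "integrable M (\<lambda>x. norm (f x) powr p)" using f by (simp add: Lp_space_def)
  have "(\<lambda>i. \<integral>x. norm (F i x - f x) powr p \<partial>M) \<longlonglongrightarrow> (\<integral>x. 0 \<partial>M)"
  \<comment> \<open>The 3 is 2 from the bound on \<open>F i\<close> plus 1 for \<open>f\<close>
    itself.\<close>
  proof (rule integral_dominated_convergence[where w = "\<lambda>x. 3 powr p * norm (f x) powr p"])
    show "integrable M (\<lambda>x. 3 powr p * norm (f x) powr p)" using int_f by simp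
    show "AE x in M. (\<lambda>i. norm (F i x - f x) powr p) \<longlonglongrightarrow> 0"
    proof (rule AE_I2)
      fix x assume "x \<in> space M"
      then have "(\<lambda>i. norm (F i x - f x)) \<longlonglongrightarrow> 0"
        using F(2) by (simp add: LIM_zero tendsto_norm_zero)
      then have "(\<lambda>i. norm (F i x - f x) powr p) \<longlonglongrightarrow> 0 powr p"
        using p by (intro tendsto_powr2) auto
      then show "(\<lambda>i. norm (F i x - f x) powr p) \<longlonglongrightarrow> 0" by simp
    qed
    show "AE x in M. norm (norm (F i x - f x) powr p) \<le> 3 powr p * norm (f x) powr p" for i
    proof (rule AE_I2)
      fix x assume "x \<in> space M"
      then have "norm (F i x - f x) \<le> 3 * norm (f x)"
        using F_le[of x i] norm_triangle_ineq4[of "F i x" "f x"] by simp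
      then have "norm (F i x - f x) powr p \<le> (3 * norm (f x)) powr p"
        using p by (intro powr_mono2) auto
      then show "norm (norm (F i x - f x) powr p) \<le> 3 powr p * norm (f x) powr p"
        by (simp add: powr_mult)
    qed
  qed simp_all
  then have "(\<lambda>i. (\<integral>x. norm (F i x - f x) powr p \<partial>M) powr (1 / p)) \<longlonglongrightarrow> 0 powr (1 / p)"
    using p by (intro tendsto_powr2) auto
  then have "(\<lambda>i. Lp_norm M p (\<lambda>x. F i x - f x)) \<longlonglongrightarrow> 0"
    by (simp add: Lp_norm_def)
  then have lim1: "(\<lambda>i. \<Phi> (F i)) \<longlonglongrightarrow> \<Phi> f"
    using cont F_Lp f unfolding Lp_continuous_def by blast
  define w where "w x = \<gamma> * 2 powr p * norm (f x) powr p + \<delta>" for x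
  \<comment> \<open>Here the condition on \<open>\<delta>\<close> enters: a nonzero constant is
    integrable only on a space of finite measure.\<close>
  have "integrable M (\<lambda>x. \<delta>)"
    using \<delta> by (cases "emeasure M (space M) = \<infinity>") (auto simp: finite_measure.integrable_const finite_measureI)
  then have int_w: "integrable M w"
    unfolding w_def using int_f by (intro Bochner_Integration.integrable_add) auto
  have W_le: "norm (W c) \<le> w x" if "norm c \<le> 2 * norm (f x)" for c x
  proof -
    have "norm c powr p \<le> (2 * norm (f x)) powr p"
      using that p by (intro powr_mono2) auto
    then have "\<gamma> * norm c powr p \<le> \<gamma> * 2 powr p * norm (f x) powr p"
      using \<open>\<gamma> \<ge> 0\<close> by (simp add: powr_mult mult_left_mono mult.assoc)
    then show ?thesis using bound[of c] by (simp add: w_def)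
  qed
  have conv: "AE x in M. (\<lambda>i. W (F i x)) \<longlonglongrightarrow> W (f x)"
    using F(2) W_cont by (intro AE_I2) (auto intro: continuous_on_tendsto_compose)
  have dom: "AE x in M. norm (W (F i x)) \<le> w x" for i
    using F_le W_le by (intro AE_I2) auto
  have meas: "(\<lambda>x. W (f x)) \<in> borel_measurable M" "(\<lambda>x. W (F i x)) \<in> borel_measurable M" for i
    by measurable
  show "integrable M (\<lambda>x. W (f x))"
    using meas int_w conv dom by (rule integrable_dominated_convergence)
  have "(\<lambda>i. \<integral>x. W (F i x) \<partial>M) \<longlonglongrightarrow> (\<integral>x. W (f x) \<partial>M)"
    using meas int_w conv dom by (rule integral_dominated_convergence)
  then show "\<Phi> f = (\<integral>x. W (f x) \<partial>M)"
    using lim1 simple_function_integral[OF F(1) F_Lp] by (auto intro: LIMSEQ_unique)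
qed

end

theorem theorem1p1:
  fixes M :: "'a measure" and p :: real
    and \<Phi> :: "('a \<Rightarrow> complex) \<Rightarrow> complex" and h :: "nat \<Rightarrow> real \<Rightarrow> real"
  assumes "p \<ge> 1"
    and "non_atomic M"
    and "emeasure M (space M) > 0"
    and "Lp_valuation M p \<Phi>"
    and "Lp_continuous M p \<Phi>"
    and "\<And>k. k \<in> {1..4} \<Longrightarrow> continuous_on UNIV (h k) \<and> h k 0 = 0"
    and "\<And>c E. E \<in> sets M \<Longrightarrow> emeasure M E < \<infinity> \<Longrightarrow>
      \<Phi> (\<lambda>x. c * indicator E x) =
        of_real ((h 1 (Re c) + h 3 (Im c)) * measure M E)
        + \<i> * of_real ((h 2 (Re c) + h 4 (Im c)) * measure M E)"
  shows "\<exists>\<gamma> \<delta> :: nat \<Rightarrow> real.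
    (\<forall>k\<in>{1..4}. \<gamma> k \<ge> 0 \<and> \<delta> k \<ge> 0 \<and> (\<forall>a. \<bar>h k a\<bar> \<le> \<gamma> k * \<bar>a\<bar> powr p + \<delta> k)) \<and>
    (\<forall>f\<in>Lp_space M p.
      integrable M (\<lambda>x. h 1 (Re (f x)) + h 3 (Im (f x))) \<and>
      integrable M (\<lambda>x. h 2 (Re (f x)) + h 4 (Im (f x))) \<and>
      \<Phi> f = of_real (\<integral>x. h 1 (Re (f x)) + h 3 (Im (f x)) \<partial>M)
        + \<i> * of_real (\<integral>x. h 2 (Re (f x)) + h 4 (Im (f x)) \<partial>M)) \<and>
    (emeasure M (space M) = \<infinity> \<longrightarrow> (\<forall>k\<in>{1..4}. \<delta> k = 0))"
proof -
  \<comment> \<open>Packing the four functions into \<open>W\<close> lets growth and representation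
    be taken from the locale; coordinates are separated afterwards.\<close>
  define W where "W c = Complex (h 1 (Re c) + h 3 (Im c)) (h 2 (Re c) + h 4 (Im c))" for c
  have h: "continuous_on UNIV (h k)" "h k 0 = 0" if "k \<in> {1,2,3,4}" for k
    using assms(6)[of k] that by auto
  have h_comp: "continuous_on UNIV (\<lambda>c. h k (Re c))" "continuous_on UNIV (\<lambda>c. h k (Im c))"
    if "k \<in> {1,2,3,4}" for k
    by (rule continuous_on_compose2[OF h(1)[OF that]]; (intro continuous_intros | simp))+
  interpret indicator_valuation M p \<Phi> W
  proof
    show "continuous_on UNIV W"
      unfolding W_def using h_comp by (intro continuous_intros) auto
    show "W 0 = 0" by (simp add: W_def h complex_eq_iff)
    show "\<Phi> (\<lambda>x. c * indicator E x) = W c * of_real (measure M E)"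
      if "E \<in> sets M" "emeasure M E < \<infinity>" for c E
      using assms(7)[OF that, of c] by (simp add: W_def complex_eq_iff)
  qed (use assms in auto)
  obtain \<gamma> \<delta> where \<gamma>: "\<gamma> \<ge> 0" "\<delta> \<ge> 0" "\<And>c. norm (W c) \<le> \<gamma> * norm c powr p + \<delta>"
    "emeasure M (space M) = \<infinity> \<Longrightarrow> \<delta> = 0"
    using growth[OF assms(2,3)] by metis
  have "\<bar>h k a\<bar> \<le> \<gamma> * \<bar>a\<bar> powr p + \<delta>" if k: "k \<in> {1..4}" for k a
  proof -
    consider "k = 1" | "k = 2" | "k = 3" | "k = 4"
      using k by force
    \<comment> \<open>As each \<open>h k\<close> vanishes at 0, the real axis isolates
      \<open>h 1\<close> and \<open>h 2\<close>, the imaginary axis \<open>h 3\<close> and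
      \<open>h 4\<close>. Both points have modulus \<open>\<bar>a\<bar>\<close>, so one pair
      \<open>\<gamma>\<close>, \<open>\<delta>\<close> serves all four functions.\<close>
    then have "\<bar>h k a\<bar> \<le> norm (W (of_real a)) \<or> \<bar>h k a\<bar> \<le> norm (W (Complex 0 a))"
      using abs_Re_le_cmod[of "W (of_real a)"] abs_Im_le_cmod[of "W (of_real a)"]
        abs_Re_le_cmod[of "W (Complex 0 a)"] abs_Im_le_cmod[of "W (Complex 0 a)"]
      by cases (auto simp: W_def h)
    then show ?thesis
      using \<gamma>(3)[of "of_real a"] \<gamma>(3)[of "Complex 0 a"] by (auto simp: cmod_def)
  qed
  moreover have "integrable M (\<lambda>x. h 1 (Re (f x)) + h 3 (Im (f x))) \<and>
      integrable M (\<lambda>x. h 2 (Re (f x)) + h 4 (Im (f x))) \<and>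
      \<Phi> f = of_real (\<integral>x. h 1 (Re (f x)) + h 3 (Im (f x)) \<partial>M)
        + \<i> * of_real (\<integral>x. h 2 (Re (f x)) + h 4 (Im (f x)) \<partial>M)"
    if "f \<in> Lp_space M p" for f
  proof -
    have rep: "integrable M (\<lambda>x. W (f x))" "\<Phi> f = (\<integral>x. W (f x) \<partial>M)"
      using integral_representation[OF \<gamma>(3,1,2) _ that] \<gamma>(4) by blast+
    have "\<Phi> f = of_real (\<integral>x. Re (W (f x)) \<partial>M) + \<i> * of_real (\<integral>x. Im (W (f x)) \<partial>M)"
      unfolding rep(2) integral_Re[OF rep(1)] integral_Im[OF rep(1)] by (rule complex_eq)
    then show ?thesis
      using integrable_Re[OF rep(1)] integrable_Im[OF rep(1)]
      unfolding W_def complex.sel by blast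
  qed
  ultimately show ?thesis
    using \<gamma>(1,2,4) by (intro exI[of _ "\<lambda>_. \<gamma>"] exI[of _ "\<lambda>_. \<delta>"]) auto
qed

end
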